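(* Let $d\ge 3$, $\mathcal A=\{0,1,\dots,d-1\}$, and let $\varphi_d:\mathcal A^*\to\mathcal A^*$ be the morphism given by $\varphi_d(i)=0(i+1)$ for $0\le i\le d-2$ and $\varphi_d(d-1)=0(d-1)(d-1)$. Then the fixed point $\mathbf u_d$ of $\varphi_d$ is rich.
   Context: The fixed point $\mathbf u_d$ is the unique infinite word starting with $0$ satisfying $\varphi_d(\mathbf u_d)=\mathbf u_d$. A finite word of length $n$ is rich if it contains $n+1$ distinct palindromic factors (the empty word included); a sequence is rich if all its finite factors are rich. *)

theory Defs
  imports "HOL-Library.Stream" "HOL-Library.Sublist"
begin

text \<open>Finite words are lists, infinite words are streams; the alphabet is \<open>{..<d}\<close>.\<close>

(* Only letters i < d matter; the else-branch is the case i = d - 1. *)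
definition phi_letter :: "nat \<Rightarrow> nat \<Rightarrow> nat list" where
  "phi_letter d i = (if i \<le> d - 2 then [0, i + 1] else [0, d - 1, d - 1])"

definition phi :: "nat \<Rightarrow> nat list \<Rightarrow> nat list" where
  "phi d w = concat (map (phi_letter d) w)"

(* The extension of phi d to infinite words; flat concatenates a stream of nonempty lists. *)
definition phi_stream :: "nat \<Rightarrow> nat stream \<Rightarrow> nat stream" where
  "phi_stream d u = flat (smap (phi_letter d) u)"

definition is_fixed_word :: "nat \<Rightarrow> nat stream \<Rightarrow> bool" where
  "is_fixed_word d u \<longleftrightarrow> u \<in> streams {..<d} \<and> shd u = 0 \<and> phi_stream d u = u"

(* Well-defined for d \<ge> 3 by ex1_fixed_word below. *)
definition fixed_word :: "nat \<Rightarrow> nat stream" where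
  "fixed_word d = (THE u. is_fixed_word d u)"

definition palindrome :: "'a list \<Rightarrow> bool" where
  "palindrome w \<longleftrightarrow> rev w = w"

definition rich :: "'a list \<Rightarrow> bool" where
  "rich w \<longleftrightarrow> card {v. sublist v w \<and> palindrome v} = length w + 1"

definition factor :: "'a list \<Rightarrow> 'a stream \<Rightarrow> bool" where
  "factor w u \<longleftrightarrow> (\<exists>p s. u = p @- w @- s)"

definition rich_stream :: "'a stream \<Rightarrow> bool" where
  "rich_stream u \<longleftrightarrow> (\<forall>w. factor w u \<longrightarrow> rich w)"

lemma phi_letter_nonempty: "phi_letter d i \<noteq> []"
  by (simp add: phi_letter_def)

lemma phi_append: "phi d (v @ w) = phi d v @ phi d w"
  by (simp add: phi_def)

lemma phi_stream_shift: "phi_stream d (w @- u) = phi d w @- phi_stream d u"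
proof (induction w)
  case (Cons a w)
  have "phi_stream d (a ## (w @- u)) = phi_letter d a @- phi_stream d (w @- u)"
    using flat_unfold[of "smap (phi_letter d) (a ## (w @- u))"]
    by (simp add: phi_stream_def phi_letter_nonempty)
  then show ?case using Cons.IH by (simp add: phi_def)
qed (simp add: phi_def)

lemma length_phi: "length w \<le> length (phi d w)"
  by (induction w) (auto simp: phi_def phi_letter_def)

lemma phi_letters:
  assumes "d \<ge> 3" "set w \<subseteq> {..<d}"
  shows "set (phi d w) \<subseteq> {..<d}"
  using assms by (induction w) (auto simp: phi_def phi_letter_def)

lemma stream_eqI_snth:
  assumes "\<And>n. u !! n = v !! n"
  shows "u = v"
proof -
  have "snth u = snth v" using assms by (rule ext)
  then have "smap (snth u) nats = smap (snth v) nats" by (rule arg_cong)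
  then show ?thesis by (simp only: stream_smap_nats[symmetric])
qed

lemma stream_eq_stakeI:
  assumes "\<And>n. stake (Suc n) u = stake (Suc n) v"
  shows "u = v"
proof (rule stream_eqI_snth)
  fix n
  show "u !! n = v !! n"
    using assms[of n] stake_nth[of n "Suc n" u] stake_nth[of n "Suc n" v] by simp
qed

lemma stake_shift_prefix: "n \<le> length w \<Longrightarrow> stake n (w @- s) = take n w"
  by (simp add: stake_shift)

lemma fixed_word_unique:
  assumes "d \<ge> 3" "is_fixed_word d u" "is_fixed_word d v"
  shows "u = v"
proof (rule stream_eq_stakeI)
  fix n
  show "stake (Suc n) u = stake (Suc n) v"
  proof (induction n)
    case 0
    show ?case using assms by (simp add: is_fixed_word_def)
  next
    case (Suc n)
    let ?w = "stake (Suc n) u"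
    have w: "?w = 0 # stake n (stl u)"
      using assms by (simp add: is_fixed_word_def)
    have "length (phi d ?w) = 2 + length (phi d (stake n (stl u)))"
      unfolding w using assms(1) by (simp add: phi_def phi_letter_def)
    then have len: "Suc (Suc n) \<le> length (phi d ?w)"
      using length_phi[of "stake n (stl u)" d] by simp
    have *: "x = phi d (stake (Suc n) x) @- phi_stream d (sdrop (Suc n) x)"
      if "is_fixed_word d x" for x
    proof -
      have "x = phi_stream d x"
        using that by (simp add: is_fixed_word_def)
      also have "\<dots> = phi_stream d (stake (Suc n) x @- sdrop (Suc n) x)"
        by (simp only: stake_sdrop)
      also have "\<dots> = phi d (stake (Suc n) x) @- phi_stream d (sdrop (Suc n) x)"
        by (rule phi_stream_shift)
      finally show ?thesis .
    qed
    have "stake (Suc (Suc n)) u = take (Suc (Suc n)) (phi d ?w)"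
      using arg_cong[OF *[OF assms(2)], of "stake (Suc (Suc n))"]
      by (rule trans) (rule stake_shift_prefix[OF len])
    moreover have "stake (Suc (Suc n)) v = take (Suc (Suc n)) (phi d ?w)"
      using arg_cong[OF *[OF assms(3)], of "stake (Suc (Suc n))"]
      unfolding Suc.IH[symmetric]
      by (rule trans) (rule stake_shift_prefix[OF len])
    ultimately show ?case by (rule trans[OF _ sym])
  qed
qed

lemma fixed_word_exists:
  assumes d: "d \<ge> 3"
  shows "\<exists>u. is_fixed_word d u"
proof -
  define W where "W k = (phi d ^^ k) [0]" for k
  have W0: "W 0 = [0]" and WS: "W (Suc k) = phi d (W k)" for k
    by (simp_all add: W_def)
  have ext: "\<exists>z. z \<noteq> [] \<and> W (Suc k) = W k @ z" for k
  proof (induction k)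
    case 0
    show ?case using d by (simp add: WS W0 phi_def phi_letter_def)
  next
    case (Suc k)
    then obtain z where z: "z \<noteq> []" "W (Suc k) = W k @ z" by blast
    have "W (Suc (Suc k)) = W (Suc k) @ phi d z"
      by (subst WS, subst z(2), simp add: phi_append WS)
    moreover have "phi d z \<noteq> []"
      using z(1) length_phi[of z d] by auto
    ultimately show ?case by blast
  qed
  have len: "k < length (W k)" for k
  proof (induction k)
    case 0
    show ?case by (simp add: W0)
  next
    case (Suc k)
    obtain z where "z \<noteq> []" "W (Suc k) = W k @ z" using ext by blast
    then show ?case using Suc by (cases z) auto
  qed
  have pre: "\<exists>z. W (k + m) = W k @ z" for k m
  proof (induction m)
    case (Suc m)
    then show ?case using ext[of "k + m"] by auto
  qed simp
  have same: "W k ! n = W m ! n" if "n < length (W k)" "n < length (W m)" for k m n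
  proof (cases "k \<le> m")
    case True
    then obtain z where "W m = W k @ z" using pre[of k "m - k"] by auto
    then show ?thesis using that(1) by (simp add: nth_append)
  next
    case False
    then obtain z where "W k = W m @ z" using pre[of m "k - m"] by auto
    then show ?thesis using that(2) by (simp add: nth_append)
  qed
  have letters: "set (W k) \<subseteq> {..<d}" for k
  proof (induction k)
    case 0
    show ?case using d by (simp add: W0)
  next
    case (Suc k)
    then show ?case using phi_letters[OF d] by (simp add: WS)
  qed
  define u where "u = smap (\<lambda>n. W n ! n) nats"
  have nth: "u !! n = W n ! n" for n by (simp add: u_def)
  have st: "stake (length (W k)) u = W k" for k
  proof (rule nth_equalityI)
    fix i assume "i < length (stake (length (W k)) u)"
    then have i: "i < length (W k)" by simp
    have "stake (length (W k)) u ! i = W i ! i"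
      using i by (simp add: nth)
    also have "\<dots> = W k ! i" by (rule same[OF len i])
    finally show "stake (length (W k)) u ! i = W k ! i" .
  qed simp
  have im: "phi_stream d u = W (Suc k) @- phi_stream d (sdrop (length (W k)) u)" for k
  proof -
    have "phi_stream d u = phi_stream d (W k @- sdrop (length (W k)) u)"
      using stake_sdrop[of "length (W k)" u] by (simp only: st)
    then show ?thesis by (simp only: phi_stream_shift WS)
  qed
  have "phi_stream d u !! n = u !! n" for n
  proof -
    have "n < length (W (Suc n))" using len[of "Suc n"] by simp
    then have "phi_stream d u !! n = W (Suc n) ! n"
      unfolding im[of n] by simp
    also have "\<dots> = W n ! n"
      by (rule same) (use len[of n] len[of "Suc n"] in simp_all)
    finally show ?thesis by (simp add: nth)
  qed
  then have "phi_stream d u = u" by (rule stream_eqI_snth)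
  moreover have "shd u = 0" using nth[of 0] by (simp add: W0)
  moreover have "u \<in> streams {..<d}"
    unfolding streams_iff_snth
  proof
    fix n
    show "u !! n \<in> {..<d}"
      unfolding nth using nth_mem[OF len[of n]] letters[of n] by (rule rev_subsetD)
  qed
  ultimately show ?thesis by (auto simp: is_fixed_word_def)
qed

lemma ex1_fixed_word: "d \<ge> 3 \<Longrightarrow> \<exists>!u. is_fixed_word d u"
  using fixed_word_exists fixed_word_unique by blast

end

theory Submission
  imports Defs
begin

text \<open>A word is rich as soon as each of its factors that is a complete return to a nonempty
  palindrome is itself a palindrome. For the fixed point this is proved by desubstitution: the
  zeros mark the starts of the blocks \<open>phi_letter d i\<close>, so a palindrome containing a zero has the
  form \<open>x @ phi d v @ [0] @ rev x\<close> with \<open>v\<close> a shorter palindrome. Since the images of \<open>d - 2\<close> and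
  \<open>d - 1\<close> share the prefix \<open>[0, d - 1]\<close>, the border \<open>x = [d - 1]\<close> only says that \<open>v\<close> is surrounded
  by letters \<open>\<ge> d - 2\<close>. The induction therefore runs over the stronger claim about consecutive
  occurrences of a palindrome whose two neighbouring letters are at least \<open>k\<close>.\<close>

section \<open>Factors of an infinite word as lists\<close>

definition subword :: "(nat \<Rightarrow> 'a) \<Rightarrow> nat \<Rightarrow> nat \<Rightarrow> 'a list" where
  "subword u i n = map u [i..<i + n]"

lemma length_subword [simp]: "length (subword u i n) = n"
  by (simp add: subword_def)

lemma nth_subword [simp]: "t < n \<Longrightarrow> subword u i n ! t = u (i + t)"
  by (simp add: subword_def)

lemma subword_0 [simp]: "subword u i 0 = []"
  by (simp add: subword_def)

lemma subword_1: "subword u i (Suc 0) = [u i]"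
  by (simp add: subword_def)

lemma subword_add: "subword u i (m + n) = subword u i m @ subword u (i + m) n"
  by (rule nth_equalityI) (auto simp: nth_append)

lemma subword_Suc: "subword u i (Suc n) = u i # subword u (Suc i) n"
  using subword_add[of u i 1 n] by (simp add: subword_1)

lemma subword_conj:
  "subword u i (Suc (Suc n)) = u i # subword u (Suc i) n @ [u (Suc (i + n))]"
  using subword_add[of u "Suc i" n 1] by (simp add: subword_Suc[of u i] subword_1)

lemma palindrome_nth:
  assumes "palindrome w" "t < length w"
  shows "w ! (length w - Suc t) = w ! t"
  using assms by (metis palindrome_def rev_nth)

lemma palindrome_conj [simp]: "palindrome (x @ w @ rev x) \<longleftrightarrow> palindrome w"
  by (simp add: palindrome_def)

lemma palindrome_Cons_snoc [simp]: "palindrome (a # w @ [a]) \<longleftrightarrow> palindrome w"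
  by (simp add: palindrome_def)

text \<open>\<open>P n\<close> is the position of the block that is the image of the letter \<open>u n\<close>.\<close>

locale phi_fixed =
  fixes d :: nat and u P :: "nat \<Rightarrow> nat"
  assumes d3: "d \<ge> 3"
    and bound: "u n < d"
    and P_0 [simp]: "P 0 = 0"
    and P_Suc: "P (Suc n) = (if u n = d - 1 then Suc (Suc (Suc (P n))) else Suc (Suc (P n)))"
    and u_P [simp]: "u (P n) = 0"
    and u_P1: "u (Suc (P n)) = (if u n = d - 1 then d - 1 else Suc (u n))"
    and u_P2: "u n = d - 1 \<Longrightarrow> u (Suc (Suc (P n))) = d - 1"
begin

section \<open>Block structure of the fixed point\<close>

lemma strict_mono_P: "strict_mono P"
  by (rule strict_mono_Suc_iff[THEN iffD2]) (simp add: P_Suc)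

lemma P_less [simp]: "P i < P j \<longleftrightarrow> i < j"
  using strict_mono_P by (simp add: strict_mono_less)

lemma P_le [simp]: "P i \<le> P j \<longleftrightarrow> i \<le> j"
  using strict_mono_P by (simp add: strict_mono_less_eq)

lemma u_P1_pos: "u (Suc (P n)) \<noteq> 0"
  using d3 by (simp add: u_P1)

lemma u_le: "u n \<le> d - 1"
  using bound[of n] by simp

text \<open>Blocks tile the positions, and only the image of \<open>d - 1\<close> has a third
  letter; a step to the right stays in the block or reaches the start of the next one.\<close>

lemma position_cases:
  obtains (zero) m where "i = P m"
  | (one) m where "i = Suc (P m)"
  | (two) m where "i = Suc (Suc (P m))" "u m = d - 1"
proof -
  have "(\<exists>m. i = P m) \<or> (\<exists>m. i = Suc (P m)) \<or> (\<exists>m. i = Suc (Suc (P m)) \<and> u m = d - 1)"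
  proof (induction i)
    case 0
    show ?case using P_0 by metis
  next
    case (Suc i)
    show ?case
      using Suc.IH
    proof (elim disjE exE conjE)
      fix m assume "i = Suc (P m)"
      then show ?thesis using P_Suc[of m] by (cases "u m = d - 1") metis+
    next
      fix m assume "i = Suc (Suc (P m))" "u m = d - 1"
      then show ?thesis using P_Suc[of m] by metis
    qed auto
  qed
  then show thesis using that by blast
qed

lemma zero_position:
  assumes "u i = 0"
  obtains m where "i = P m"
  using assms d3 u_P1_pos u_P2 by (cases i rule: position_cases) auto

text \<open>Every block starts with a zero, so two adjacent nonzero letters lie in one block, and
  only the image of \<open>d - 1\<close> has room for both.\<close>

lemma nonzero_after_nonzero:
  assumes "u i \<noteq> 0" "u (Suc i) \<noteq> 0"
  obtains m where "i = Suc (P m)" "u m = d - 1" "u i = d - 1" "u (Suc i) = d - 1"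
    "Suc (Suc i) = P (Suc m)"
proof (cases i rule: position_cases)
  case (one m)
  then have "u m = d - 1"
    using assms P_Suc[of m] u_P[of "Suc m"] by (auto split: if_splits)
  with one show ?thesis using that u_P1[of m] u_P2[of m] P_Suc[of m] by simp
next
  case (two m)
  then show ?thesis using assms P_Suc[of m] u_P[of "Suc m"] by auto
qed (use assms in simp)

lemma nonzero_pair_iff: "u i \<noteq> 0 \<and> u (Suc i) \<noteq> 0 \<longleftrightarrow> u i = d - 1 \<and> u (Suc i) = d - 1"
proof
  assume "u i \<noteq> 0 \<and> u (Suc i) \<noteq> 0"
  then show "u i = d - 1 \<and> u (Suc i) = d - 1"
    by (metis nonzero_after_nonzero)
qed (use d3 in simp)

lemma no_three_nonzero:
  assumes "u i \<noteq> 0" "u (Suc i) \<noteq> 0"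
  shows "u (Suc (Suc i)) = 0"
  using assms by (rule nonzero_after_nonzero) simp

section \<open>Unique decoding and reversal of images\<close>

lemma phi_letter_cases:
  "a < d \<Longrightarrow> phi_letter d a = (if a = d - 1 then [0, d - 1, d - 1] else [0, Suc a])"
  using d3 by (auto simp: phi_letter_def)

lemma subword_letter:
  "subword u (P i) (length (phi_letter d (u i))) = phi_letter d (u i)"
  using u_P1[of i] u_P2[of i]
  by (simp add: phi_letter_cases[OF bound] subword_Suc)

lemma P_Suc_phi: "P (Suc i) = P i + length (phi_letter d (u i))"
  by (simp add: phi_letter_cases[OF bound] P_Suc)

lemma phi_Nil [simp]: "phi d [] = []"
  by (simp add: phi_def)

lemma phi_Cons: "phi d (a # w) = phi_letter d a @ phi d w"
  by (simp add: phi_def)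

lemma P_add: "P (i + n) = P i + length (phi d (subword u i n))"
  by (induction n arbitrary: i) (simp_all add: subword_Suc phi_Cons P_Suc_phi flip: add_Suc)

lemma subword_P: "subword u (P i) (length (phi d (subword u i n))) = phi d (subword u i n)"
proof (induction n arbitrary: i)
  case (Suc n)
  show ?case
    using Suc.IH[of "Suc i"]
    by (simp add: subword_Suc phi_Cons subword_add subword_letter P_Suc_phi)
qed simp

lemma subword_P_diff:
  assumes "i \<le> j"
  shows "subword u (P i) (P j - P i) = phi d (subword u i (j - i))"
  using subword_P[of i "j - i"] P_add[of i "j - i"] assms by simp

lemma subword_P_zero:
  assumes "i \<le> j"
  shows "subword u (P i) (Suc (P j - P i)) = phi d (subword u i (j - i)) @ [0]"
  using subword_P_diff[OF assms] subword_add[of u "P i" "P j - P i" 1] assms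
  by (simp add: subword_1)

lemma hd_phi_zero: "(phi d w @ [0]) ! 0 = 0"
  by (cases w) (auto simp: phi_Cons phi_letter_def)

text \<open>The closing \<open>0\<close> makes the image uniquely decodable; it is needed at the end
  of \<open>v\<close> because the image of \<open>d - 2\<close> is a prefix of that of
  \<open>d - 1\<close>.\<close>

lemma decode:
  assumes "subword u (P l) (Suc (length (phi d v))) = phi d v @ [0]" "set v \<subseteq> {..<d}"
  shows "subword u l (length v) = v"
  using assms
proof (induction v arbitrary: l)
  case (Cons a v)
  let ?s = "phi d v @ [0]"
  have a: "a < d" using Cons.prems by simp
  have s: "?s ! 0 = 0" by (rule hd_phi_zero)
  have eq: "u (P l + t) = (phi_letter d a @ ?s) ! t" if "t < length (phi_letter d a @ ?s)" for t
    using arg_cong[OF Cons.prems(1), of "\<lambda>w. w ! t"] that by (simp add: phi_Cons)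
  \<comment> \<open>The second letter of the block determines \<open>a\<close> unless it is
    \<open>d - 1\<close>; then the third letter separates \<open>d - 2\<close> (a zero follows) from
    \<open>d - 1\<close>.\<close>
  have ul: "u l = a"
    using eq[of 1] eq[of 2] s a u_P1[of l] u_P2[of l] d3 P_Suc[of l] u_P[of "Suc l"]
    by (auto simp: phi_letter_cases numeral_2_eq_2 split: if_splits)
  have "subword u (P (Suc l)) (Suc (length (phi d v))) = ?s"
    using Cons.prems(1) subword_letter[of l]
      subword_add[of u "P l" "length (phi_letter d a)" "Suc (length (phi d v))"]
    by (simp add: phi_Cons P_Suc_phi ul)
  then have "subword u (Suc l) (length v) = v"
    using Cons by simp
  then show ?case by (simp add: subword_Suc ul)
qed simp

text \<open>Each letter image is \<open>0\<close> followed by a palindrome, so reversing it and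
  moving the \<open>0\<close> to the other end gives it back.\<close>

lemma rev_phi: "rev (phi d v @ [0]) = phi d (rev v) @ [0]"
proof (induction v)
  case (Cons a v)
  have "rev (phi d (a # v) @ [0]) = rev (phi d v @ [0]) @ rev (phi_letter d a)"
    by (simp add: phi_Cons)
  also have "\<dots> = phi d (rev v) @ [0] @ rev (phi_letter d a)"
    by (simp only: Cons.IH append_assoc)
  also have "[0] @ rev (phi_letter d a) = phi_letter d a @ [0]"
    by (simp add: phi_letter_def)
  finally show ?case by (simp add: phi_append phi_Cons)
qed simp

lemma set_subword: "set (subword u i n) \<subseteq> {..<d}"
  using bound by (auto simp: subword_def)

lemma palindrome_phiI: "palindrome v \<Longrightarrow> palindrome (phi d v @ [0])"
  using rev_phi[of v] by (simp add: palindrome_def)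

lemma length_phi_rev: "length (phi d (rev v)) = length (phi d v)"
  using arg_cong[OF rev_phi[of v], of length] by simp

text \<open>The factor and its reversal have the same image, read at the same position, so unique
  decoding makes them equal.\<close>

lemma palindrome_phiD:
  assumes "palindrome (phi d (subword u i n) @ [0])"
  shows "palindrome (subword u i n)"
proof -
  let ?v = "subword u i n"
  have "phi d (rev ?v) @ [0] = phi d ?v @ [0]"
    using assms rev_phi[of ?v] by (simp add: palindrome_def)
  moreover have "subword u (P i) (Suc (length (phi d ?v))) = phi d ?v @ [0]"
    using subword_P_zero[of i "i + n"] P_add[of i n] by simp
  ultimately have "subword u i (length (rev ?v)) = rev ?v"
    using set_subword[of i n] by (intro decode) (simp_all add: length_phi_rev)
  then show ?thesis by (simp add: palindrome_def)
qed

section \<open>Gaps between consecutive occurrences of letters\<close>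

text \<open>Induction on \<open>k\<close>: the blocks containing a letter at least
  \<open>Suc k\<close> are those of letters at least \<open>k\<close>. A nonempty gap for
  \<open>Suc k\<close> is therefore \<open>phi d g @ [0]\<close> with \<open>g\<close> a gap for
  \<open>k\<close>.\<close>

lemma return_to_large:
  assumes "k < d" "i < j" "u i \<ge> k" "u j \<ge> k" "\<And>r. i < r \<Longrightarrow> r < j \<Longrightarrow> u r < k"
  shows "palindrome (subword u (Suc i) (j - Suc i))"
  using assms
proof (induction k arbitrary: i j)
  case 0
  then have "j = Suc i" by (metis Suc_lessI lessI not_less0)
  then show ?case by (simp add: palindrome_def)
next
  case (Suc k)
  show ?case
  proof (cases "j = Suc i")
    case True
    then show ?thesis by (simp add: palindrome_def)
  next
    case False
    then have ij: "Suc i < j" using Suc.prems by simp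
    have "u (Suc i) = 0"
    proof (rule ccontr)
      assume "u (Suc i) \<noteq> 0"
      then show False
        using nonzero_after_nonzero[of i] Suc.prems(1,3) Suc.prems(5)[of "Suc i"] ij by force
    qed
    then obtain m where m: "Suc i = P m" by (rule zero_position)
    have "u (j - 1) = 0"
    proof (rule ccontr)
      assume "u (j - 1) \<noteq> 0"
      then show False
        using nonzero_after_nonzero[of "j - 1"] Suc.prems(1,4) Suc.prems(5)[of "j - 1"] ij
        by force
    qed
    then obtain l where l: "j - 1 = P l" by (rule zero_position)
    have jl: "j = Suc (P l)" using l ij by simp
    have "m \<noteq> 0" using m by (intro notI) simp
    then obtain m' where m': "m = Suc m'" using not0_implies_Suc by blast
    have ml: "m \<le> l" using ij m jl P_le[of m l] by linarith
    \<comment> \<open>\<open>i\<close> is the last position of block \<open>m'\<close>: the third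
      letter if \<open>u m' = d - 1\<close>, the second otherwise.\<close>
    have um: "u m' \<ge> k"
    proof (cases "u m' = d - 1")
      case False
      then have "i = Suc (P m')" using m P_Suc[of m'] m' by simp
      then show ?thesis using Suc.prems(3) u_P1[of m'] False by simp
    qed (use Suc.prems in simp)
    have ul: "u l \<ge> k" using Suc.prems(1,4) u_P1[of l] jl by (auto split: if_splits)
    have "u r < k" if "m' < r" "r < l" for r
    proof (rule ccontr)
      assume "\<not> u r < k"
      then have "u (Suc (P r)) \<ge> Suc k" using Suc.prems(1) u_P1[of r] by auto
      moreover have "i < Suc (P r)" using m that m' P_le[of m r] by linarith
      moreover have "Suc (P r) < j" using jl that by simp
      ultimately show False using Suc.prems(5) by fastforce
    qed
    then have "palindrome (subword u (Suc m') (l - Suc m'))"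
      using Suc.prems(1) um ul ml m' by (intro Suc.IH) auto
    then have "palindrome (phi d (subword u m (l - m)) @ [0])"
      unfolding m' by (rule palindrome_phiI)
    moreover have "j - Suc i = Suc (P l - P m)"
      using jl m ml P_le[of m l] by linarith
    ultimately show ?thesis using subword_P_zero[OF ml] m by simp
  qed
qed

text \<open>A letter strictly between \<open>0\<close> and \<open>d - 1\<close> arises only from its
  predecessor, so its gaps are images of gaps of a smaller letter. A gap of \<open>0\<close> is the
  rest of a single block. The letter \<open>d - 1\<close> has two preimages, but it is maximal, so
  \<open>return_to_large\<close> covers it.\<close>

lemma return_to_letter:
  assumes "c < d" "i < j" "u i = c" "u j = c" "\<And>r. i < r \<Longrightarrow> r < j \<Longrightarrow> u r \<noteq> c"
  shows "palindrome (subword u (Suc i) (j - Suc i))"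
  using assms
proof (induction c arbitrary: i j)
  case 0
  obtain m where m: "i = P m" using 0 zero_position by metis
  obtain l where l: "j = P l" using 0 zero_position by metis
  have "l = Suc m"
  proof (rule ccontr)
    assume "l \<noteq> Suc m"
    then have "i < P (Suc m)" "P (Suc m) < j" using m l 0 by simp_all
    then show False using 0(5) by fastforce
  qed
  then show ?case
    using m l u_P1[of m] u_P2[of m]
    by (auto simp: P_Suc subword_Suc palindrome_def numeral_2_eq_2)
next
  case (Suc c)
  show ?case
  proof (cases "Suc c = d - 1")
    case True
    show ?thesis
    proof (rule return_to_large)
      show "u r < Suc c" if "i < r" "r < j" for r
        using Suc.prems(5)[OF that] u_le[of r] True by simp
    qed (use Suc.prems in auto)
  next
    case False
    have *: "\<exists>m. i = Suc (P m) \<and> u m = c" if "u i = Suc c" for i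
    proof (cases i rule: position_cases)
      case (one m)
      then show ?thesis using u_P1[of m] that False by (auto split: if_splits)
    qed (use that False u_P2 in auto)
    obtain m where m: "i = Suc (P m)" "u m = c" using * Suc.prems by blast
    obtain l where l: "j = Suc (P l)" "u l = c" using * Suc.prems by blast
    have ml: "m < l" using Suc.prems m l by simp
    have "u r \<noteq> c" if "m < r" "r < l" for r
    proof
      assume "u r = c"
      then have "u (Suc (P r)) = Suc c" using False Suc.prems(1) by (simp add: u_P1)
      then show False using that m l Suc.prems(5)[of "Suc (P r)"] by simp
    qed
    then have "palindrome (subword u (Suc m) (l - Suc m))"
      using Suc.prems(1) m l ml by (intro Suc.IH) auto
    then have "palindrome (phi d (subword u (Suc m) (l - Suc m)) @ [0])"
      by (rule palindrome_phiI)
    moreover have "Suc i = P (Suc m)"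
      using False Suc.prems(1) m by (auto simp: P_Suc)
    moreover have "j - Suc i = Suc (P l - P (Suc m))"
      using calculation(2) ml l P_le[of "Suc m" l] by linarith
    ultimately show ?thesis using subword_P_zero[of "Suc m" l] ml by simp
  qed
qed

text \<open>A nonzero pair is the tail of the image of \<open>d - 1\<close>, so the inside comes
  from a gap between consecutive letters \<open>d - 1\<close>. The first conclusion serves
  two-letter words; the second, with one letter less at each end, serves the empty word between
  nonzero neighbours.\<close>

lemma return_to_double_letter:
  assumes "p < q" "u p \<noteq> 0" "u (Suc p) \<noteq> 0" "u q \<noteq> 0" "u (Suc q) \<noteq> 0"
    and none: "\<And>r. p < r \<Longrightarrow> r < q \<Longrightarrow> u r = 0 \<or> u (Suc r) = 0"
  shows "palindrome (subword u p (q + 2 - p))" "palindrome (subword u (Suc p) (q - p))"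
proof -
  obtain m where m: "p = Suc (P m)" "u m = d - 1" "u p = d - 1" "u (Suc p) = d - 1"
      "Suc (Suc p) = P (Suc m)"
    using assms(2,3) by (rule nonzero_after_nonzero)
  obtain l where l: "q = Suc (P l)" "u l = d - 1" "u q = d - 1" "u (Suc q) = d - 1"
    using assms(4,5) by (rule nonzero_after_nonzero) blast
  have ml: "m < l" using assms(1) m l by simp
  have "u r \<noteq> d - 1" if "m < r" "r < l" for r
  proof
    assume "u r = d - 1"
    then have "u (Suc (P r)) = d - 1" "u (Suc (Suc (P r))) = d - 1"
      by (simp_all add: u_P1 u_P2)
    then show False using that m l d3 none[of "Suc (P r)"] by simp
  qed
  then have "palindrome (subword u (Suc m) (l - Suc m))"
    using d3 m l ml by (intro return_to_letter[of "d - 1"]) auto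
  then have pal: "palindrome (phi d (subword u (Suc m) (l - Suc m)) @ [0])"
    by (rule palindrome_phiI)
  let ?w = "subword u (Suc (Suc p)) (q - Suc (Suc p))"
  have lt: "P (Suc m) \<le> P l" using ml by simp
  then have "q - Suc (Suc p) = Suc (P l - P (Suc m))"
    unfolding m(5) l(1) by linarith
  then have w: "palindrome ?w"
    using subword_P_zero[of "Suc m" l] ml pal m(5) by simp
  have len: "q - p = Suc (Suc (q - Suc (Suc p)))" "q + 2 - p = Suc (Suc (q - p))"
    using lt m(5) l(1) by linarith+
  have "Suc (Suc p + (q - Suc (Suc p))) = q"
    using len(1) assms(1) by linarith
  then have *: "subword u (Suc p) (q - p) = (d - 1) # ?w @ [d - 1]"
    unfolding len(1) subword_conj by (simp only: m(4) l(3))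
  then show pal': "palindrome (subword u (Suc p) (q - p))" using w by simp
  have "subword u p (q + 2 - p) = (d - 1) # subword u (Suc p) (q - p) @ [d - 1]"
    unfolding len(2) subword_conj using m(3) l(4) assms(1) by (simp del: One_nat_def)
  then show "palindrome (subword u p (q + 2 - p))" using pal' by simp
qed

text \<open>The start of the infinite word counts as a left neighbour at least \<open>k\<close> for every \<open>k\<close>,
  which makes the notion compatible with \<open>phi\<close>.\<close>

definition occ :: "nat \<Rightarrow> nat list \<Rightarrow> nat \<Rightarrow> bool" where
  "occ k w i \<longleftrightarrow> subword u i (length w) = w \<and> (i = 0 \<or> k \<le> u (i - 1)) \<and> k \<le> u (i + length w)"

section \<open>Desubstitution of occurrences with bounded neighbours\<close>

lemma occ_0: "occ 0 w i \<longleftrightarrow> subword u i (length w) = w"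
  by (simp add: occ_def)

lemma occ_nth: "occ k w i \<Longrightarrow> t < length w \<Longrightarrow> w ! t = u (i + t)"
  unfolding occ_def by (metis nth_subword)

lemma subword_phi_iff:
  assumes "set v \<subseteq> {..<d}"
  shows "subword u (P s) (Suc (length (phi d v))) = phi d v @ [0] \<longleftrightarrow> subword u s (length v) = v"
    (is "?L \<longleftrightarrow> ?R")
proof
  assume ?R
  then show ?L
    using subword_P_zero[of s "s + length v"] P_add[of s "length v"] by simp
qed (rule decode[OF _ assms])

text \<open>Since \<open>x\<close> ends at a block start, the middle part is aligned with the blocks
  and is decoded independently of \<open>x\<close> and \<open>y\<close>. The length formula assumes
  the occurrence of \<open>v\<close> because \<open>P\<close> measures the blocks actually read in
  \<open>u\<close>.\<close>

lemma subword_image_iff: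
  assumes "set v \<subseteq> {..<d}" "i + length x = P s" "w = x @ (phi d v @ [0]) @ y"
  shows "subword u i (length w) = w \<longleftrightarrow> subword u i (length x) = x \<and>
    subword u s (length v) = v \<and> subword u (Suc (P (s + length v))) (length y) = y" (is ?iff)
    and "subword u s (length v) = v \<Longrightarrow> i + length w = Suc (P (s + length v)) + length y" (is "_ \<Longrightarrow> ?len")
proof -
  have P: "P (s + length v) = P s + length (phi d v)" if "subword u s (length v) = v"
    using P_add[of s "length v"] that by simp
  then show "subword u s (length v) = v \<Longrightarrow> ?len" using assms by simp
  have "subword u i (length w) = subword u i (length x) @
      subword u (P s) (Suc (length (phi d v))) @
      subword u (P s + Suc (length (phi d v))) (length y)"
    using assms(2) subword_add[of u i "length x" "Suc (length (phi d v)) + length y"]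
      subword_add[of u "P s" "Suc (length (phi d v))" "length y"]
    by (simp add: assms(3))
  then have "subword u i (length w) = w \<longleftrightarrow> subword u i (length x) = x \<and>
      subword u (P s) (Suc (length (phi d v))) = phi d v @ [0] \<and>
      subword u (P s + Suc (length (phi d v))) (length y) = y"
    unfolding assms(3) by (simp del: append_assoc)
  then show ?iff using P subword_phi_iff[OF assms(1)] by auto
qed

lemma P_Suc_le: "Suc (Suc (P s)) \<le> P (Suc s)"
  by (simp add: P_Suc)

lemma u_before_P: "u (P (Suc s) - 1) = (if u s = d - 1 then d - 1 else Suc (u s))"
  using u_P1[of s] u_P2[of s] by (simp add: P_Suc)

text \<open>The outer letters are the neighbours of \<open>v\<close> raised by one and capped at
  \<open>d - 1\<close>. The cap is harmless for \<open>k < d\<close>; for \<open>k = 0\<close> both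
  bounds are void, in accordance with the truncated \<open>k - 1\<close>.\<close>

lemma occ_image:
  assumes "k < d" "set v \<subseteq> {..<d}"
  shows "occ k (phi d v @ [0]) (P s) \<longleftrightarrow> occ (k - 1) v s"
proof -
  let ?w = "phi d v @ [0]"
  have *: "subword u (P s) (length ?w) = ?w \<longleftrightarrow> subword u s (length v) = v"
    using subword_phi_iff[OF assms(2)] by simp
  have len: "P s + length ?w = Suc (P (s + length v))" if "subword u s (length v) = v"
    using subword_image_iff(2)[OF assms(2), of "P s" "[]" s ?w "[]"] that by simp
  have "(P s = 0 \<or> k \<le> u (P s - 1)) \<longleftrightarrow> (s = 0 \<or> k - 1 \<le> u (s - 1))"
  proof (cases s)
    case (Suc s')
    then show ?thesis using assms(1) u_before_P[of s'] P_Suc_le[of s'] by auto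
  qed simp
  moreover have "k \<le> u (Suc (P t)) \<longleftrightarrow> k - 1 \<le> u t" for t
    using assms(1) by (auto simp: u_P1)
  ultimately show ?thesis unfolding occ_def * using len by (metis (no_types))
qed

text \<open>The only preimage of the border letter \<open>c\<close> is \<open>c - 1\<close>, so the
  border becomes part of the preimage word. The position \<open>P (Suc s) - 1\<close> is the last
  one of block \<open>s\<close>.\<close>

lemma occ_image_letter:
  assumes "0 < c" "c < d - 1" "set v \<subseteq> {..<d}"
  shows "occ 0 ([c] @ (phi d v @ [0]) @ [c]) (P (Suc s) - 1) \<longleftrightarrow> occ 0 ((c - 1) # v @ [c - 1]) s"
proof -
  have "occ 0 ([c] @ (phi d v @ [0]) @ [c]) (P (Suc s) - 1) \<longleftrightarrow>
    u (P (Suc s) - 1) = c \<and> subword u (Suc s) (length v) = v \<and> u (Suc (P (Suc s + length v))) = c"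
    unfolding occ_0
    using subword_image_iff(1)[OF assms(3), of "P (Suc s) - 1" "[c]" "Suc s" _ "[c]"] P_Suc_le[of s]
    by (simp add: subword_1)
  also have "\<dots> \<longleftrightarrow> u s = c - 1 \<and> subword u (Suc s) (length v) = v \<and> u (Suc s + length v) = c - 1"
    unfolding u_before_P u_P1 using assms by auto
  also have "\<dots> \<longleftrightarrow> occ 0 ((c - 1) # v @ [c - 1]) s"
    by (auto simp: occ_0 subword_conj)
  finally show ?thesis .
qed

text \<open>Blocks ending in \<open>d - 1\<close> are those of \<open>d - 2\<close> and
  \<open>d - 1\<close>, which gives the bound \<open>d - 2\<close> on the neighbours of
  \<open>v\<close>. A positive \<open>k\<close> also demands a nonzero letter beyond each border,
  and then only the blocks of \<open>d - 1\<close> remain.\<close>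

lemma occ_image_last_letter:
  assumes "k < d" "set v \<subseteq> {..<d}"
  shows "occ k ([d - 1] @ (phi d v @ [0]) @ [d - 1]) (P (Suc s) - 1) \<longleftrightarrow>
    occ (if k = 0 then d - 2 else d - 1) v (Suc s)"
proof -
  let ?w = "[d - 1] @ (phi d v @ [0]) @ [d - 1]"
  have *: "subword u (P (Suc s) - 1) (length ?w) = ?w \<longleftrightarrow>
    u (P (Suc s) - 1) = d - 1 \<and> subword u (Suc s) (length v) = v \<and> u (Suc (P (Suc s + length v))) = d - 1"
    using subword_image_iff(1)[OF assms(2), of "P (Suc s) - 1" "[d - 1]" "Suc s" _ "[d - 1]"] P_Suc_le[of s]
    by (simp add: subword_1)
  have len: "P (Suc s) - 1 + length ?w = Suc (Suc (P (Suc s + length v)))"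
    if "subword u (Suc s) (length v) = v"
    using subword_image_iff(2)[OF assms(2), of "P (Suc s) - 1" "[d - 1]" "Suc s" ?w "[d - 1]"]
      that P_Suc_le[of s] by simp
  have before: "u (P (Suc s) - 1) = d - 1 \<and> (P (Suc s) - 1 = 0 \<or> k \<le> u (P (Suc s) - 1 - 1)) \<longleftrightarrow>
      (if k = 0 then d - 2 else d - 1) \<le> u s"
    unfolding u_before_P using u_le[of s] d3 assms(1) u_P1[of s] by (auto simp: P_Suc)
  have after: "u (Suc (P t)) = d - 1 \<and> k \<le> u (Suc (Suc (P t))) \<longleftrightarrow>
      (if k = 0 then d - 2 else d - 1) \<le> u t" for t
    using u_le[of t] d3 assms(1) u_P1[of t] u_P2[of t] u_P[of "Suc t"] by (auto simp: P_Suc split: if_splits)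
  have "occ k ?w (P (Suc s) - 1) \<longleftrightarrow> (u (P (Suc s) - 1) = d - 1 \<and> (P (Suc s) - 1 = 0 \<or> k \<le> u (P (Suc s) - 1 - 1)))
      \<and> subword u (Suc s) (length v) = v
      \<and> (u (Suc (P (Suc s + length v))) = d - 1 \<and> k \<le> u (Suc (Suc (P (Suc s + length v)))))"
    unfolding occ_def * using len by (metis (no_types))
  then show ?thesis unfolding before after by (auto simp: occ_def)
qed

text \<open>Only the block of \<open>d - 1\<close> has this tail, and a neighbour at least
  \<open>d - 1\<close> equals \<open>d - 1\<close>.\<close>

lemma occ_image_double_letter:
  assumes "set v \<subseteq> {..<d}"
  shows "occ 0 ([d - 1, d - 1] @ (phi d v @ [0]) @ [d - 1, d - 1]) (P (Suc s) - 2) \<longleftrightarrow>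
    occ (d - 1) v (Suc s)"
proof -
  let ?x = "[d - 1, d - 1]"
  have before: "subword u (P (Suc s) - 2) 2 = ?x \<longleftrightarrow> d - 1 \<le> u s"
    using d3 u_le[of s] u_P1[of s] u_P2[of s] by (auto simp: numeral_2_eq_2 subword_Suc P_Suc)
  have after: "subword u (Suc (P t)) 2 = ?x \<longleftrightarrow> d - 1 \<le> u t" for t
    using d3 u_le[of t] u_P1[of t] u_P2[of t] u_P[of "Suc t"]
    by (auto simp: numeral_2_eq_2 subword_Suc P_Suc split: if_splits)
  have "occ 0 (?x @ (phi d v @ [0]) @ ?x) (P (Suc s) - 2) \<longleftrightarrow>
    subword u (P (Suc s) - 2) 2 = ?x \<and> subword u (Suc s) (length v) = v \<and>
    subword u (Suc (P (Suc s + length v))) 2 = ?x"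
    unfolding occ_0
    using subword_image_iff(1)[OF assms(1), of "P (Suc s) - 2" ?x "Suc s" _ ?x] P_Suc_le[of s]
    by (simp add: numeral_2_eq_2)
  then show ?thesis unfolding before after by (auto simp: occ_def)
qed

text \<open>The window spanned by the occurrences of \<open>w\<close> is
  \<open>x @ phi d g @ [0] @ rev x\<close>, where \<open>g\<close> is the window spanned by the
  occurrences of \<open>v\<close>.\<close>

lemma palindrome_image_window:
  assumes v: "set v \<subseteq> {..<d}" and w: "w = x @ (phi d v @ [0]) @ rev x"
    and p: "p + length x = P m" "subword u p (length w) = w"
    and q: "q + length x = P l" "subword u q (length w) = w"
    and ml: "m < l" and pal: "palindrome (subword u m (l + length v - m))"
  shows "palindrome (subword u p (q + length w - p))"
proof -
  let ?l = "l + length v"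
  note P = subword_image_iff[OF v p(1) w]
  note Q = subword_image_iff[OF v q(1) w]
  have len: "q + length w = Suc (P ?l) + length x" using Q q(2) by simp
  have Pl: "P m \<le> P ?l" using ml by simp
  have *: "q + length w - p = length x + (Suc (P ?l - P m) + length x)"
    unfolding len using p(1) Pl by linarith
  have "P m + Suc (P ?l - P m) = Suc (P ?l)" using Pl by simp
  then have "subword u p (q + length w - p) = subword u p (length x) @
      subword u (P m) (Suc (P ?l - P m)) @ subword u (Suc (P ?l)) (length x)"
    unfolding * by (simp only: subword_add p(1))
  also have "\<dots> = x @ (phi d (subword u m (?l - m)) @ [0]) @ rev x"
    using P(1) p(2) Q(1) q(2) subword_P_zero[of m ?l] ml by simp
  finally show ?thesis using palindrome_phiI[OF pal] by (simp only: palindrome_conj)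
qed

section \<open>Borders of palindromes and the main induction\<close>

text \<open>At most two consecutive letters are nonzero; a positive \<open>k\<close> makes both
  neighbours nonzero as well and leaves no room for a letter of \<open>w\<close>.\<close>

lemma occ_zero_free:
  assumes "occ k w i" "0 \<notin> set w"
  shows "length w \<le> 2" "k \<noteq> 0 \<Longrightarrow> w = []"
proof -
  have nz: "u (i + t) \<noteq> 0" if "t < length w" for t
    using assms occ_nth[OF assms(1) that] that nth_mem by metis
  show "length w \<le> 2"
    using nz[of 0] nz[of 1] nz[of 2] no_three_nonzero[of i] by (force simp: not_le)
  show "w = []" if "k \<noteq> 0"
  proof (rule ccontr)
    assume "w \<noteq> []"
    then have len: "0 < length w" by simp
    \<comment> \<open>Position \<open>0\<close> is exempt from the left bound, but its letter is
      zero.\<close>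
    have "i \<noteq> 0" using nz[OF len] u_P[of 0] by (cases i) (auto simp del: u_P)
    then have "u (i - 1) \<noteq> 0" "Suc (i - 1) = i"
      using assms(1) that by (auto simp: occ_def)
    then have "u (Suc i) = 0"
      using nz[OF len] no_three_nonzero[of "i - 1"] by simp
    moreover have "u (Suc i) \<noteq> 0"
    proof (cases "length w = 1")
      case True
      then show ?thesis using assms(1) that by (auto simp: occ_def)
    next
      case False
      then show ?thesis using nz[of 1] len by simp
    qed
    ultimately show False by simp
  qed
qed

text \<open>Cut at the first zero. The suffix \<open>rev x\<close> is free of zeros, so it begins
  after that zero and leaves a nonempty middle.\<close>

lemma palindrome_split_at_zero:
  fixes w :: "nat list"
  assumes "palindrome w" "0 \<in> set w"
  obtains x z where "w = x @ z @ rev x" "0 \<notin> set x" "palindrome z" "z \<noteq> []" "hd z = 0"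
proof -
  obtain x r where w: "w = x @ 0 # r" "0 \<notin> set x"
    using assms(2) by (metis split_list_first)
  have "rev w = w" using assms(1) by (simp add: palindrome_def)
  then have sx: "suffix (rev x) w" using w(1) by (metis rev_append suffixI)
  have s0: "suffix (0 # r) w" using w(1) by (simp add: suffixI)
  have "\<not> suffix (0 # r) (rev x)"
    using w(2) by (metis list.set_intros(1) set_mono_suffix set_rev subsetD)
  then have "suffix (rev x) (0 # r)" using suffix_same_cases[OF sx s0] by blast
  then obtain z where z: "0 # r = z @ rev x" by (auto simp: suffix_def)
  then have "z \<noteq> []" using w(2) by (metis append_Nil list.set_intros(1) set_rev)
  moreover have "hd z = 0" using z calculation by (metis hd_append2 list.sel(1))
  moreover have "w = x @ z @ rev x" using w(1) z by simp
  moreover have "palindrome z" using calculation(3) assms(1) by simp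
  ultimately show thesis using that w(2) by blast
qed

text \<open>Here \<open>x\<close> is a zero-free word ending where a block ends, hence one or two
  letters of its tail. If it is the whole tail, it is preceded by the zero of the block, which
  forces \<open>k = 0\<close>; only a single \<open>d - 1\<close> can be preceded by a nonzero
  letter.\<close>

lemma occ_prefix_cases:
  assumes occ: "occ k (x @ y) p" and m: "p + length x = P m" and x: "0 \<notin> set x" "x \<noteq> []"
  obtains (last) "x = [d - 1]"
  | (letter) c where "k = 0" "x = [c]" "0 < c" "c < d - 1"
  | (double) "k = 0" "x = [d - 1, d - 1]"
proof -
  have nth: "x ! t = u (p + t)" if "t < length x" for t
    using occ_nth[OF occ, of t] that by (simp add: nth_append)
  have "P m \<noteq> 0" using m x by (cases x) auto
  then obtain n where n: "m = Suc n" by (cases m) auto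
  \<comment> \<open>Otherwise the zero at \<open>P n\<close> would lie inside
    \<open>x\<close>.\<close>
  have np: "P n < p"
  proof (rule ccontr)
    assume "\<not> P n < p"
    then obtain t where t: "P n = p + t" using le_Suc_ex by (metis not_le)
    then have "t < length x" using m n P_less[of n m] by linarith
    then show False using nth t u_P[of n] x(1) nth_mem by metis
  qed
  have k: "k \<le> u (p - 1)" using occ np by (simp add: occ_def)
  have pos: "0 < length x" using x(2) by simp
  have "length x = 1 \<or> length x = 2 \<and> u n = d - 1"
  proof (cases "u n = d - 1")
    case True
    then have "P m = Suc (Suc (Suc (P n)))" using n P_Suc[of n] by simp
    then show ?thesis using True np m pos by linarith
  next
    case False
    then have "P m = Suc (Suc (P n))" using n P_Suc[of n] by simp
    then show ?thesis using np m pos by linarith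
  qed
  then consider "p = P m - 1" "length x = 1" | "p = Suc (P n)" "length x = 2" "u n = d - 1"
    using m n P_Suc[of n] by auto
  then show thesis
  proof cases
    case 1
    then have xc: "x = [u p]" using nth[of 0] by (cases x) auto
    show thesis
    proof (cases "u p = d - 1")
      case False
      then have "u n \<noteq> d - 1" using 1 n u_before_P[of n] by auto
      then have "p - 1 = P n" using 1 n by (simp add: P_Suc)
      then have "k = 0" using k by simp
      then show thesis using letter xc x(1) u_le[of p] False by auto
    qed (use last xc in auto)
  next
    case 2
    then have "x = [d - 1, d - 1]"
      using nth[of 0] nth[of 1] u_P1[of n] u_P2[of n]
      by (intro nth_equalityI) (auto simp: less_2_cases_iff numeral_2_eq_2 less_Suc_eq)
    then show thesis using double k 2 by simp
  qed
qed

text \<open>For \<open>k = 0\<close> this says that complete returns to palindromes are palindromes.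
  The bound \<open>k\<close> varies in the induction because desubstitution changes it.\<close>

lemma palindrome_between_occs:
  assumes "k < d" "palindrome w" "p < q" "occ k w p" "occ k w q"
    "\<And>r. p < r \<Longrightarrow> r < q \<Longrightarrow> \<not> occ k w r"
  shows "palindrome (subword u p (q + length w - p))"
  using assms
proof (induction "length w" arbitrary: w k p q rule: less_induct)
  case less
  show ?case
  proof (cases "0 \<in> set w")
    case False
    note zf = occ_zero_free[OF less.prems(4) False]
    show ?thesis
    proof (cases "k = 0")
      case True
      consider "w = []" | c where "w = [c]" | a b where "w = [a, b]"
        using zf(1) by (cases w; cases "tl w"; force)
      then show ?thesis
      proof cases
        case 1
        \<comment> \<open>Without a bound the empty word occurs everywhere.\<close>
        then have "q = Suc p"
          using less.prems(3) less.prems(6)[of "Suc p"] True by (force simp: occ_0)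
        then show ?thesis using 1 by (simp add: subword_1 palindrome_def)
      next
        case (2 c)
        have *: "occ k w i \<longleftrightarrow> u i = c" for i by (simp add: True 2 occ_0 subword_1)
        have "palindrome (subword u (Suc p) (q - Suc p))"
          using less.prems bound[of p] unfolding * by (intro return_to_letter[of c]) auto
        moreover have "q + length w - p = Suc (Suc (q - Suc p))" "Suc (p + (q - Suc p)) = q"
          using less.prems(3) 2 by simp_all
        moreover have "u p = c" "u q = c" using less.prems * by simp_all
        ultimately show ?thesis by (simp add: subword_conj)
      next
        case (3 a b)
        have *: "occ k w i \<longleftrightarrow> u i = a \<and> u (Suc i) = b" for i
          by (simp add: True 3 occ_0 subword_Suc)
        have "a \<noteq> 0" "b \<noteq> 0" using False 3 by auto
        then have **: "occ k w i \<longleftrightarrow> u i \<noteq> 0 \<and> u (Suc i) \<noteq> 0" for i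
          using less.prems(4) unfolding * by (metis nonzero_pair_iff)
        show ?thesis
          using return_to_double_letter(1)[of p q] less.prems(3-6) 3 unfolding **
          by simp
      qed
    next
      case k: False
      then have w: "w = []" by (rule zf(2))
      have "u 0 = 0" using u_P[of 0] by (simp del: u_P)
      then have pos: "i \<noteq> 0" if "occ k w i" for i
        using that k w by (auto simp: occ_def)
      \<comment> \<open>With a positive bound the empty word occurs exactly between two adjacent
        nonzero letters; the left one is at \<open>i\<close>, hence the shift.\<close>
      have *: "occ k w (Suc i) \<longleftrightarrow> u i \<noteq> 0 \<and> u (Suc i) \<noteq> 0" for i
      proof -
        have "k \<le> d - 1" using less.prems(1) by simp
        then show ?thesis using k nonzero_pair_iff[of i] by (auto simp: w occ_def)
      qed
      obtain p' q' where pq: "p = Suc p'" "q = Suc q'"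
        using pos[OF less.prems(4)] pos[OF less.prems(5)] by (cases p; cases q) auto
      have "u r = 0 \<or> u (Suc r) = 0" if "p' < r" "r < q'" for r
        using less.prems(6)[of "Suc r"] that pq * by auto
      then have "palindrome (subword u (Suc p') (q' - p'))"
        using less.prems(3-5) unfolding pq *
        by (intro return_to_double_letter(2)) auto
      then show ?thesis by (simp add: w pq)
    qed
  next
    case True
    obtain x z where xz: "w = x @ z @ rev x" "0 \<notin> set x" "palindrome z" "z \<noteq> []" "hd z = 0"
      using palindrome_split_at_zero[OF less.prems(2) True] .
    have z: "z ! t = u (i + length x + t)" if "occ k w i" "t < length z" for i t
      using occ_nth[OF that(1), of "length x + t"] that(2) xz(1)
      by (simp add: nth_append add.assoc)
    have z0: "z ! 0 = 0" using xz(4,5) by (simp add: hd_conv_nth)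
    have zlast: "z ! (length z - 1) = 0"
      using palindrome_nth[OF xz(3), of 0] xz(4) z0 by simp
    obtain m where m: "p + length x = P m"
      using z[OF less.prems(4), of 0] xz(4) z0 zero_position by (metis add_0_right length_greater_0_conv)
    obtain l where l: "q + length x = P l"
      using z[OF less.prems(5), of 0] xz(4) z0 zero_position by (metis add_0_right length_greater_0_conv)
    obtain m' where m': "p + length x + (length z - 1) = P m'"
      using z[OF less.prems(4), of "length z - 1"] xz(4) zlast zero_position
      by (metis diff_less length_greater_0_conv zero_less_one)
    \<comment> \<open>The blocks from the first zero of \<open>z\<close> up to its last zero, read
      at the occurrence of \<open>w\<close> at \<open>p\<close>, give the preimage.\<close>
    define v where "v = subword u m (m' - m)"
    have "m \<le> m'" using m m' P_le[of m m'] by linarith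
    moreover have "length z = Suc (P m' - P m)" using m m' xz(4) by (cases z) auto
    moreover have "z = subword u (P m) (length z)"
      using z[OF less.prems(4)] m by (intro nth_equalityI) auto
    ultimately have zv: "z = phi d v @ [0]" using subword_P_zero[of m m'] v_def by simp
    have v: "set v \<subseteq> {..<d}" unfolding v_def by (rule set_subword)
    have palv: "palindrome v" using xz(3) palindrome_phiD unfolding zv v_def by blast
    have w: "w = x @ (phi d v @ [0]) @ rev x" using xz(1) zv by simp
    have ml: "m < l" using m l less.prems(3) P_less[of m l] by linarith
    have lenv: "length v < length w" using length_phi[of v d] w by simp
    have lift: ?thesis if "palindrome (subword u m (l + length v - m))"
      using palindrome_image_window[OF v w m _ l _ ml that] less.prems(4,5)
      by (simp add: occ_def)
    \<comment> \<open>An occurrence of \<open>v\<close> strictly between \<open>m\<close> and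
      \<open>l\<close> would yield one of \<open>w\<close> strictly between \<open>p\<close> and
      \<open>q\<close>, so the induction hypothesis applies to \<open>v\<close>. For
      \<open>m \<le> s\<close> the subtraction \<open>P s - length x\<close> is not
      truncated.\<close>
    have step: ?thesis
      if K: "K < d" and iff: "\<And>s. m \<le> s \<Longrightarrow> occ k w (P s - length x) \<longleftrightarrow> occ K v s" for K
    proof (rule lift, rule less.hyps[OF lenv K palv ml])
      show "occ K v m" using iff[of m] less.prems(4) by (simp flip: m)
      show "occ K v l" using iff[of l] less.prems(5) ml by (simp flip: l)
      show "\<not> occ K v r" if "m < r" "r < l" for r
      proof -
        have "P m < P r" "P r < P l" using that by simp_all
        then have "p < P r - length x" "P r - length x < q" using m l by linarith+
        then show ?thesis using less.prems(6) iff[of r] that by simp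
      qed
    qed
    show ?thesis
    proof (cases "x = []")
      case True
      show ?thesis
      proof (rule step[of "k - 1"])
        show "occ k w (P s - length x) \<longleftrightarrow> occ (k - 1) v s" for s
          using occ_image[OF less.prems(1) v, of s] by (simp add: True w)
      qed (use less.prems(1) in simp)
    next
      case False
      have "P m \<noteq> 0" using m False by (cases x) auto
      then obtain n where n: "m = Suc n" by (cases m) auto
      have Suc: "\<exists>s'. s = Suc s'" if "m \<le> s" for s
        using that n by (cases s) auto
      have occ: "occ k (x @ (phi d v @ [0]) @ rev x) p" using less.prems(4) w by simp
      from occ m xz(2) False show ?thesis
      proof (cases rule: occ_prefix_cases)
        case last
        show ?thesis
        proof (rule step)
          fix s assume "m \<le> s"
          then obtain s' where s': "s = Suc s'" using Suc by blast
          have w': "w = [d - 1] @ (phi d v @ [0]) @ [d - 1]" "length x = 1"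
            using w last by simp_all
          show "occ k w (P s - length x) \<longleftrightarrow> occ (if k = 0 then d - 2 else d - 1) v s"
            unfolding s' w' by (rule occ_image_last_letter[OF less.prems(1) v])
        qed (use d3 in auto)
      next
        case (letter c)
        \<comment> \<open>The border prescribes the neighbours of \<open>v\<close> exactly, not by a
          lower bound, so the induction hypothesis is applied to the extended word. Its length
          \<open>length v + 2\<close> is still below \<open>length w = length (phi d v) + 3\<close>.
          The outer letters are stripped from the window afterwards.\<close>
        let ?v = "(c - 1) # v @ [c - 1]"
        have iff: "occ k w (P (Suc s) - 1) \<longleftrightarrow> occ 0 ?v s" for s
          using occ_image_letter[OF letter(3,4) v] by (simp add: w letter)
        obtain l' where l': "l = Suc l'" using ml by (cases l) auto
        have "p = P (Suc n) - 1" "q = P (Suc l') - 1"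
          using m n l l' letter(2) by auto
        then have occ_n: "occ 0 ?v n" and occ_l': "occ 0 ?v l'"
          using iff less.prems(4,5) by simp_all
        have "palindrome (subword u n (l' + length ?v - n))"
        proof (rule less.hyps)
          have "length v + length v \<le> length (phi d v)"
            by (induction v) (auto simp: phi_Cons phi_letter_def)
          then show "length ?v < length w" by (simp add: w letter)
          show "\<not> occ 0 ?v r" if "n < r" "r < l'" for r
          proof -
            have "P m < P (Suc r)" "P (Suc r) < P l" using that n l' by simp_all
            moreover have "Suc p = P m" "Suc q = P l" using m l letter(2) by simp_all
            ultimately have "p < P (Suc r) - 1" "P (Suc r) - 1 < q" by linarith+
            then show ?thesis using less.prems(6) iff[of r] by simp
          qed
        qed (use d3 palv ml n l' occ_n occ_l' in auto)
        moreover have "l' + length ?v - n = Suc (Suc (l + length v - m))"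
          using ml n l' by simp
        moreover have "u n = c - 1"
          using occ_nth[OF occ_n, of 0] by simp
        moreover have "u (Suc (n + (l + length v - m))) = c - 1"
        proof -
          have "Suc (n + (l + length v - m)) = l' + Suc (length v)"
            using ml n l' by simp
          then show ?thesis
            using occ_nth[OF occ_l', of "Suc (length v)"] by (simp add: nth_append)
        qed
        ultimately have "palindrome (subword u m (l + length v - m))"
          by (simp add: subword_conj n)
        then show ?thesis by (rule lift)
      next
        case double
        show ?thesis
        proof (rule step)
          fix s assume "m \<le> s"
          then obtain s' where s': "s = Suc s'" using Suc by blast
          have w': "w = [d - 1, d - 1] @ (phi d v @ [0]) @ [d - 1, d - 1]" "length x = 2"
            using w double(2) by simp_all
          show "occ k w (P s - length x) \<longleftrightarrow> occ (d - 1) v s"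
            unfolding s' w' double(1) by (rule occ_image_double_letter[OF v])
        qed (use d3 in auto)
      qed
    qed
  qed
qed

end

section \<open>Palindromic complete returns and richness\<close>

text \<open>Appending a letter adds exactly one palindrome, the longest palindromic suffix
  \<open>p\<close>: an earlier occurrence of \<open>p\<close> would start a longer palindromic
  suffix, and every shorter palindromic suffix has occurred already.\<close>

lemma rich_if_complete_returns_palindromic:
  assumes "\<And>v r. sublist r w \<Longrightarrow> palindrome v \<Longrightarrow> v \<noteq> [] \<Longrightarrow> strict_prefix v r \<Longrightarrow> suffix v r \<Longrightarrow>
    (\<And>s t. r = s @ v @ t \<Longrightarrow> s = [] \<or> t = []) \<Longrightarrow> palindrome r"
  shows "rich w"
  using assms
proof (induction w rule: rev_induct)
  case Nil
  have "{v. sublist v ([] :: 'a list) \<and> palindrome v} = {[]}"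
    by (auto simp: palindrome_def)
  then show ?case by (simp add: rich_def)
next
  case (snoc a w)
  have "rich w"
    by (rule snoc.IH, rule snoc.prems) (auto intro: sublist_order.order.trans)
  let ?S = "{v. suffix v (w @ [a]) \<and> palindrome v}"
  let ?F = "\<lambda>w. {v. sublist v w \<and> palindrome v}"
  have fin: "finite ?S" by (rule finite_subset[of _ "set (suffixes (w @ [a]))"]) auto
  have a: "[a] \<in> ?S" by (auto simp: palindrome_def)
  have "Max (length ` ?S) \<in> length ` ?S" using fin a by (intro Max_in finite_imageI) blast+
  then obtain p where p: "p \<in> ?S" "Max (length ` ?S) = length p" by blast
  have max: "length v \<le> length p" if "v \<in> ?S" for v
    unfolding p(2)[symmetric] using fin that by (intro Max_ge) auto
  have "\<not> sublist p w"
  proof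
    assume "sublist p w"
    then have ex: "\<exists>n s t. w = s @ p @ t \<and> length t = n" by (auto simp: sublist_def)
    \<comment> \<open>The shortest remainder \<open>t\<close> selects the last occurrence of
      \<open>p\<close> in \<open>w\<close>, so \<open>?r\<close> has no inner occurrence of
      \<open>p\<close>.\<close>
    define n where "n = (LEAST n. \<exists>s t. w = s @ p @ t \<and> length t = n)"
    obtain s t where st: "w = s @ p @ t" "length t = n"
      using LeastI_ex[OF ex] unfolding n_def by blast
    have least: "length t \<le> length t'" if "w = s' @ p @ t'" for s' t'
      unfolding st(2) n_def using that by (intro Least_le) blast
    let ?r = "p @ t @ [a]"
    have suf: "suffix ?r (w @ [a])" using st(1) by (simp add: suffix_def)
    have "palindrome ?r"
    proof (rule snoc.prems)
      show "sublist ?r (w @ [a])" using suf by blast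
      show "palindrome p" using p by simp
      show "p \<noteq> []" using max[OF a] by auto
      show "strict_prefix p ?r" by (simp add: strict_prefix_def)
      show "suffix p ?r"
        using p(1) by (intro suffix_length_suffix[OF _ suf]) auto
      show "s' = [] \<or> t' = []" if eq: "?r = s' @ p @ t'" for s' t'
      proof (rule ccontr)
        assume "\<not> (s' = [] \<or> t' = [])"
        then obtain b t'' where t': "t' = t'' @ [b]" "s' \<noteq> []" by (cases t' rule: rev_cases) auto
        then have eq': "p @ t = s' @ p @ t''" using eq by simp
        then have "length t \<le> length t''" using least[of "s @ s'" t''] st(1) by simp
        moreover have "length t = length s' + length t''" using arg_cong[OF eq', of length] by simp
        ultimately show False using t'(2) by simp
      qed
    qed
    then have "?r \<in> ?S" using suf by simp
    then show False using max[of ?r] by simp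
  qed
  moreover have "?F (w @ [a]) = insert p (?F w)"
  proof (intro equalityI subsetI)
    fix v assume v: "v \<in> ?F (w @ [a])"
    show "v \<in> insert p (?F w)"
    proof (cases "sublist v w")
      case False
      then have vS: "v \<in> ?S" using v by (simp add: sublist_snoc)
      then have "suffix v p" using p max[OF vS] suffix_length_suffix by blast
      \<comment> \<open>Reflection in \<open>p\<close> moves \<open>v\<close> to the front of
        \<open>p\<close>; if \<open>v\<close> is shorter than \<open>p\<close>, it then ends before
        the new letter.\<close>
      then have "prefix (rev v) (rev p)" by (simp add: suffix_to_prefix)
      then have "prefix v p" using p vS by (simp add: palindrome_def)
      then obtain t where t: "p = v @ t" by (auto simp: prefix_def)
      obtain s where s: "w @ [a] = s @ p" using p by (auto simp: suffix_def)
      have "t = []"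
      proof (rule ccontr)
        assume "t \<noteq> []"
        then obtain b t' where "t = t' @ [b]" by (cases t rule: rev_cases) auto
        then have "w = s @ v @ t'" using s t by simp
        then have "sublist v w" unfolding sublist_def by blast
        then show False using False by simp
      qed
      then show ?thesis using t by simp
    qed (use v in auto)
  qed (use p in \<open>auto intro: sublist_order.order.trans\<close>)
  moreover have "finite (?F w)"
    by (rule finite_subset[of _ "set (sublists w)"]) auto
  ultimately show ?case using \<open>rich w\<close> by (simp add: rich_def)
qed

section \<open>Richness of the fixed point\<close>

text \<open>Once a complete return is located in \<open>u\<close>, its two ends are consecutive,
  possibly overlapping, occurrences of \<open>v\<close>, and \<open>palindrome_between_occs\<close>
  applies with \<open>k = 0\<close>.\<close>

lemma (in phi_fixed) rich_subword: "rich (subword u i n)"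
proof (rule rich_if_complete_returns_palindromic)
  fix v r
  assume r: "sublist r (subword u i n)" and v: "palindrome v" "v \<noteq> []"
    and pre: "strict_prefix v r" and suf: "suffix v r"
    and none: "\<And>s t. r = s @ v @ t \<Longrightarrow> s = [] \<or> t = []"
  obtain s t where st: "subword u i n = s @ r @ t" using r by (auto simp: sublist_def)
  define p where "p = i + length s"
  have n: "n = length s + (length r + length t)" using arg_cong[OF st, of length] by simp
  have r: "r = subword u p (length r)"
    using st unfolding n subword_add p_def by simp
  obtain y where y: "r = v @ y" "y \<noteq> []" using pre by (auto simp: strict_prefix_def prefix_def)
  obtain x where x: "r = x @ v" using suf by (auto simp: suffix_def)
  have occ_iff: "occ 0 v (p + j) \<longleftrightarrow> (\<exists>s t. r = s @ v @ t \<and> length s = j)"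
    if j: "j + length v \<le> length r" for j
  proof
    assume "occ 0 v (p + j)"
    moreover have "length r = j + (length v + (length r - j - length v))" using j by simp
    then have "r = subword u p j @ subword u (p + j) (length v) @
        subword u (p + j + length v) (length r - j - length v)"
      using r by (metis subword_add)
    ultimately show "\<exists>s t. r = s @ v @ t \<and> length s = j"
      unfolding occ_0 by (metis length_subword)
  next
    assume "\<exists>s t. r = s @ v @ t \<and> length s = j"
    then obtain s t where s: "r = s @ v @ t" "length s = j" by blast
    then have "length r = j + (length v + length t)" by simp
    then have "s @ v @ t = subword u p j @ subword u (p + j) (length v) @
        subword u (p + j + length v) (length t)"
      using r s(1) by (metis subword_add)
    then show "occ 0 v (p + j)" using s(2) by (simp add: occ_0)
  qed
  have len: "length r = length x + length v" using x by simp
  have "palindrome (subword u p (p + length x + length v - p))"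
  proof (rule palindrome_between_occs)
    show "palindrome v" by fact
    have "length y = length x" using len arg_cong[OF y(1), of length] by simp
    then show "p < p + length x" using y(2) by auto
    show "occ 0 v p" using occ_iff[of 0] y by simp
    show "occ 0 v (p + length x)" 
    proof -
      have "\<exists>s t. r = s @ v @ t \<and> length s = length x"
        using x by (intro exI[of _ x] exI[of _ "[]"]) simp
      then show ?thesis using occ_iff[of "length x"] len by simp
    qed
    show "\<not> occ 0 v k" if k: "p < k" "k < p + length x" for k
    proof
      assume "occ 0 v k"
      moreover have "k - p + length v \<le> length r" "p + (k - p) = k" using k len by linarith+
      ultimately obtain s t where s: "r = s @ v @ t" "length s = k - p"
        using occ_iff[of "k - p"] by auto
      then show False using none[OF s(1)] k len by auto
    qed
  qed (use d3 in simp)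
  then show "palindrome r" using r len by simp
qed

text \<open>As the word is fixed, what follows the image of its first \<open>n\<close> letters is
  the image of the remaining word, which begins with the image of the letter at
  \<open>n\<close>.\<close>

lemma phi_fixed_fixed_word:
  assumes d: "d \<ge> 3"
  shows "phi_fixed d (snth (fixed_word d)) (\<lambda>n. length (phi d (stake n (fixed_word d))))"
proof -
  let ?u = "fixed_word d"
  let ?P = "\<lambda>n. length (phi d (stake n ?u))"
  have fw: "is_fixed_word d ?u"
    unfolding fixed_word_def by (rule theI'[OF ex1_fixed_word[OF d]])
  then have fixed: "phi_stream d ?u = ?u" and bound: "?u !! n < d" for n
    by (auto simp: is_fixed_word_def streams_iff_snth)
  have unfold: "phi_stream d s = phi_letter d (shd s) @- phi_stream d (stl s)" for s
    using phi_stream_shift[of d "[shd s]" "stl s"] by (simp add: phi_def)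
  have P_Suc: "?P (Suc n) = ?P n + length (phi_letter d (?u !! n))" for n
    by (simp only: stake_Suc phi_append length_append) (simp add: phi_def)
  have block: "?u !! (?P n + t) = (phi_letter d (?u !! n) @- phi_stream d (sdrop (Suc n) ?u)) !! t" for n t
  proof -
    have "?u = phi d (stake n ?u) @- phi_stream d (sdrop n ?u)"
      using phi_stream_shift[of d "stake n ?u" "sdrop n ?u"] fixed by (simp only: stake_sdrop)
    then have "?u !! (?P n + t) = phi_stream d (sdrop n ?u) !! t"
      by (metis shift_snth_ge diff_add_inverse le_add1)
    then show ?thesis using unfold[of "sdrop n ?u"] by simp
  qed
  have letter: "phi_letter d a = (if a = d - 1 then [0, d - 1, d - 1] else [0, Suc a])" if "a < d" for a
    using that d by (auto simp: phi_letter_def)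
  show ?thesis
  proof
    show "?P (Suc n) = (if ?u !! n = d - 1 then Suc (Suc (Suc (?P n))) else Suc (Suc (?P n)))" for n
      using P_Suc[of n] letter[OF bound[of n]] by simp
    show "?u !! ?P n = 0" for n
      using block[of n 0] letter[OF bound[of n]] by (simp split: if_splits)
    show "?u !! Suc (?P n) = (if ?u !! n = d - 1 then d - 1 else Suc (?u !! n))" for n
      using block[of n 1] letter[OF bound[of n]] by (simp split: if_splits)
    show "?u !! Suc (Suc (?P n)) = d - 1" if "?u !! n = d - 1" for n
      using block[of n 2] letter[OF bound[of n]] that by (simp add: numeral_2_eq_2)
  qed (use d bound in \<open>simp_all add: phi_def\<close>)
qed

lemma factor_eq_subword:
  assumes "factor w u"
  obtains i where "w = subword (snth u) i (length w)"
proof -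
  obtain p s where "u = p @- w @- s" using assms by (auto simp: factor_def)
  then have "w = subword (snth u) (length p) (length w)"
    by (intro nth_equalityI) (auto simp: shift_snth_ge)
  then show thesis using that by blast
qed

theorem theorem13:
  fixes d :: nat
  assumes "d \<ge> 3"
  shows "rich_stream (fixed_word d)"
proof -
  interpret phi_fixed d "snth (fixed_word d)" "\<lambda>n. length (phi d (stake n (fixed_word d)))"
    using assms by (rule phi_fixed_fixed_word)
  show ?thesis
    unfolding rich_stream_def
  proof (intro allI impI)
    fix w assume "factor w (fixed_word d)"
    then obtain i where "w = subword (snth (fixed_word d)) i (length w)"
      by (rule factor_eq_subword)
    then show "rich w" using rich_subword[of i "length w"] by simp
  qed
qed

end
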